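(* Let $\omega\in A^{\mathbb N}$ and $k\in\mathbb{Z}^+\cup\{+\infty\}$. If $\rho^{(k)}_\omega(n_0)<q^{(k)}(n_0)$ for some $n_0\ge1$, where $q^{(k)}(n)=n+1$ for $n\le 2k-1$ and $q^{(k)}(n)=2k$ for $n\ge 2k$, then $\omega$ is ultimately periodic.
   Context: For $k\in\mathbb{Z}^+\cup\{+\infty\}$ define the relation $\mathcal R_k$ on $A^*$: $u\,\mathcal R_k\,v$ iff $u$ and $v$ are Abelian equivalent (i.e. $|u|_a=|v|_a$ for every letter $a$) and $u,v$ share a common prefix and a common suffix of length $k-1$; if $|u|<k-1$ (in particular always when $k=+\infty$), $u\,\mathcal R_k\,v$ means $u=v$. For $\omega\in A^{\mathbb N}$, $\rho^{(k)}_\omega(n)$ is the number of $\mathcal R_k$-equivalence classes of factors of $\omega$ of length $n$. $\omega=a_0a_1\cdots$ is ultimately periodic if there is $p\ge1$ with $a_{i+p}=a_i$ for all sufficiently large $i$. When $k=+\infty$, $q^{(k)}(n)=n+1$ for all $n$. *)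

theory Defs
  imports "HOL-Library.Sublist" "HOL-Library.Multiset" "HOL-Library.Extended_Nat"
begin

text \<open>The alphabet is an arbitrary type \<open>'a\<close>, finite words are lists over it, and infinite
  words are functions on \<^typ>\<open>nat\<close>. The parameter \<open>k\<close> ranges over the nonzero extended naturals,
  where \<open>\<infinity> - 1 = \<infinity>\<close> and \<open>2 * \<infinity> = \<infinity>\<close>.\<close>

definition abelian_equivalent :: "'a list \<Rightarrow> 'a list \<Rightarrow> bool" where
  "abelian_equivalent u v \<longleftrightarrow> (\<forall>a. count_list u a = count_list v a)"

definition k_rel :: "enat \<Rightarrow> ('a list \<times> 'a list) set" where
  "k_rel k = {(u, v).
     if enat (length u) < k - 1 then u = v
     else abelian_equivalent u v
        \<and> (\<exists>p. enat (length p) = k - 1 \<and> prefix p u \<and> prefix p v)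
        \<and> (\<exists>s. enat (length s) = k - 1 \<and> suffix s u \<and> suffix s v)}"

definition factors_of_length :: "(nat \<Rightarrow> 'a) \<Rightarrow> nat \<Rightarrow> 'a list set" where
  "factors_of_length \<omega> n = {map \<omega> [i..<i + n] | i. True}"

text \<open>Since \<^const>\<open>card\<close> is \<open>0\<close> on infinite sets, the number of elements is taken in \<^typ>\<open>enat\<close>;
  this is what allows the alphabet to be infinite.\<close>

definition ecard :: "'b set \<Rightarrow> enat" where
  "ecard S = (if finite S then enat (card S) else \<infinity>)"

definition complexity :: "enat \<Rightarrow> (nat \<Rightarrow> 'a) \<Rightarrow> nat \<Rightarrow> enat" where
  "complexity k \<omega> n = ecard (factors_of_length \<omega> n // k_rel k)"

definition q_bound :: "enat \<Rightarrow> nat \<Rightarrow> enat" where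
  "q_bound k n = (if enat n \<le> 2 * k - 1 then enat (n + 1) else 2 * k)"

definition ultimately_periodic :: "(nat \<Rightarrow> 'a) \<Rightarrow> bool" where
  "ultimately_periodic \<omega> \<longleftrightarrow> (\<exists>p\<ge>1. \<exists>N. \<forall>i\<ge>N. \<omega> (i + p) = \<omega> i)"

lemma abelian_equivalent_length:
  assumes "abelian_equivalent u v"
  shows "length u = length v"
proof -
  have "mset u = mset v"
    using assms by (simp add: abelian_equivalent_def multiset_eq_iff count_mset)
  then show ?thesis by (rule mset_eq_length)
qed

lemma prefix_length_unique:
  assumes "prefix p u" "prefix p' u" "enat (length p) = m" "enat (length p') = m"
  shows "p = p'"
  using assms by (metis enat.inject order_refl prefix_length_prefix prefix_order.antisym)

lemma suffix_length_unique:
  assumes "suffix p u" "suffix p' u" "enat (length p) = m" "enat (length p') = m"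
  shows "p = p'"
  using assms by (metis enat.inject order_refl suffix_length_suffix suffix_order.antisym)

lemma equiv_k_rel: "equiv UNIV (k_rel k :: ('a list \<times> 'a list) set)"
  (is "equiv _ ?R")
proof (rule equivI)
  show "?R \<subseteq> UNIV \<times> UNIV" by simp
  show "refl ?R"
  proof (rule reflI)
    fix u :: "'a list"
    show "(u, u) \<in> ?R"
    proof (cases "enat (length u) < k - 1")
      case True
      then show ?thesis by (simp add: k_rel_def)
    next
      case False
      then obtain m where m: "k - 1 = enat m" "m \<le> length u"
        by (cases "k - 1") auto
      have "length (take m u) = m" "prefix (take m u) u"
        "length (drop (length u - m) u) = m" "suffix (drop (length u - m) u) u"
        using m by (auto simp: take_is_prefix suffix_drop)
      then have "\<exists>p. enat (length p) = k - 1 \<and> prefix p u"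
        "\<exists>s. enat (length s) = k - 1 \<and> suffix s u"
        using m by metis+
      then show ?thesis using False
        by (simp add: k_rel_def abelian_equivalent_def)
    qed
  qed
  show "sym ?R"
    by (rule symI)
      (auto simp: k_rel_def abelian_equivalent_def split: if_splits
         dest: abelian_equivalent_length[unfolded abelian_equivalent_def])
  show "trans ?R"
  proof (rule transI)
    fix u v w :: "'a list"
    assume uv: "(u, v) \<in> ?R" and vw: "(v, w) \<in> ?R"
    show "(u, w) \<in> ?R"
    proof (cases "enat (length u) < k - 1")
      case True
      then show ?thesis using uv vw by (simp add: k_rel_def)
    next
      case False
      with uv have ab: "abelian_equivalent u v" by (simp add: k_rel_def)
      then have nv: "\<not> enat (length v) < k - 1"
        using False abelian_equivalent_length by metis
      from uv False obtain p s where 1: "enat (length p) = k - 1" "prefix p u" "prefix p v"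
        "enat (length s) = k - 1" "suffix s u" "suffix s v" by (auto simp: k_rel_def)
      from vw nv obtain p' s' where 2: "enat (length p') = k - 1" "prefix p' v" "prefix p' w"
        "enat (length s') = k - 1" "suffix s' v" "suffix s' w" by (auto simp: k_rel_def)
      have "p = p'" "s = s'"
        using prefix_length_unique[OF 1(3) 2(2) 1(1) 2(1)]
          suffix_length_unique[OF 1(6) 2(5) 1(4) 2(4)] by auto
      moreover have "abelian_equivalent u w"
        using ab vw nv by (auto simp: k_rel_def abelian_equivalent_def)
      ultimately show ?thesis using False 1 2 by (auto simp: k_rel_def)
    qed
  qed
qed

lemma k_rel_infinity [simp]: "k_rel \<infinity> = Id"
  by (auto simp: k_rel_def)

lemma q_bound_enat:
  assumes "k \<ge> 1"
  shows "q_bound (enat k) n = enat (if n \<le> 2 * k - 1 then n + 1 else 2 * k)"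
  using assms by (auto simp: q_bound_def numeral_eq_enat one_enat_def)

lemma q_bound_infinity: "q_bound \<infinity> n = enat (n + 1)"
  by (simp add: q_bound_def numeral_eq_enat)

end

theory Submission
  imports Defs
begin

text \<open>Suppose \<open>\<omega>\<close> is not ultimately periodic. For \<open>n \<le> 2k - 1\<close> the relation is equality on words of
  length \<open>n\<close>, and the bound is that of Morse and Hedlund. For \<open>n \<ge> 2k\<close> write \<open>m = k - 1\<close> and
  \<open>b = n - m\<close>. A class is then given by its \<^emph>\<open>state\<close>: the two windows of length \<open>m\<close> at positions \<open>i\<close>
  and \<open>i + b\<close>, together with the multiset of letters in \<open>[i, i + b)\<close>. With \<open>b\<close> fixed, let \<open>c(m)\<close> be
  the number of states. Then \<open>c(0) \<ge> 2\<close>, and a right special factor of length \<open>b + m\<close> gives a state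
  with two continuations, so \<open>c(m + 1) \<ge> c(m) + 1\<close>. If equality holds, that state is the only one
  with two continuations; comparing first differences shows that then a state determines the whole factor of length \<open>b + m\<close>, so \<open>c(m) \<ge> b + m + 1\<close>. Either way
  \<open>c(m) \<ge> 2m + 2\<close> as long as \<open>m < b\<close>.\<close>

section \<open>Counting images of finite sets\<close>

lemma card_image_le_if_determined:
  assumes "finite (g ` X)"
    and "\<And>x y. x \<in> X \<Longrightarrow> y \<in> X \<Longrightarrow> g x = g y \<Longrightarrow> f x = f y"
  shows "finite (f ` X)" and "card (f ` X) \<le> card (g ` X)"
proof -
  have eq: "f ` X = (\<lambda>c. f (inv_into X g c)) ` (g ` X)"
  proof -
    have "f (inv_into X g (g x)) = f x" if "x \<in> X" for x
      using that assms(2) by (metis f_inv_into_f imageI inv_into_into)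
    then show ?thesis by (force simp: image_image)
  qed
  show "finite (f ` X)" "card (f ` X) \<le> card (g ` X)"
    unfolding eq using assms(1) card_image_le by auto
qed

text \<open>Deleting \<open>D\<close> loses no value of \<open>f\<close>, so \<open>E - D\<close>
  already has at least as many elements as the image.\<close>

lemma card_image_add_card_le:
  assumes "finite E" "D \<subseteq> E" "f ` E \<subseteq> f ` (E - D)"
  shows "card (f ` E) + card D \<le> card E"
proof -
  have "card (f ` E) \<le> card (f ` (E - D))"
    using assms by (intro card_mono) auto
  also have "\<dots> \<le> card (E - D)"
    using assms by (intro card_image_le) auto
  also have "\<dots> = card E - card D"
    using assms by (intro card_Diff_subset) (auto intro: finite_subset)
  finally show ?thesis
    using card_mono[OF assms(1,2)] by linarith
qed

section \<open>Factors, right special factors and the Morse-Hedlund bound\<close>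

definition factor :: "(nat \<Rightarrow> 'a) \<Rightarrow> nat \<Rightarrow> nat \<Rightarrow> 'a list" where
  "factor \<omega> n i = map \<omega> [i..<i + n]"

lemma length_factor [simp]: "length (factor \<omega> n i) = n"
  by (simp add: factor_def)

lemma nth_factor [simp]: "d < n \<Longrightarrow> factor \<omega> n i ! d = \<omega> (i + d)"
  by (simp add: factor_def)

lemma factor_eq_iff: "factor \<omega> n i = factor \<omega> n j \<longleftrightarrow> (\<forall>d<n. \<omega> (i + d) = \<omega> (j + d))"
  by (auto simp: list_eq_iff_nth_eq)

lemma take_factor: "m \<le> n \<Longrightarrow> take m (factor \<omega> n i) = factor \<omega> m i"
  by (rule nth_equalityI) auto

lemma drop_factor: "drop b (factor \<omega> (b + m) i) = factor \<omega> m (i + b)"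
  by (rule nth_equalityI) (auto simp: add.assoc)

lemma factors_of_length_eq: "factors_of_length \<omega> n = range (factor \<omega> n)"
  by (auto simp: factors_of_length_def factor_def)

lemma mset_factor_Suc: "mset (factor \<omega> n (Suc i)) + {#\<omega> i#} = mset (factor \<omega> n i) + {#\<omega> (i + n)#}"
proof -
  have "\<omega> i # factor \<omega> n (Suc i) = factor \<omega> n i @ [\<omega> (i + n)]"
    unfolding factor_def by (induction n) auto
  from arg_cong[OF this, of mset] show ?thesis by simp
qed

text \<open>If every factor of length \<open>n\<close> forced its next letter, one repeated factor
  would make the two continuing words agree forever, giving a period.\<close>

lemma right_special_factor:
  assumes "\<not> ultimately_periodic \<omega>" and fin: "finite (range (factor \<omega> n))"
  obtains i j where "factor \<omega> n i = factor \<omega> n j" and "\<omega> (i + n) \<noteq> \<omega> (j + n)"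
proof (rule ccontr)
  assume "\<not> thesis"
  with that have det: "factor \<omega> n i = factor \<omega> n j \<Longrightarrow> \<omega> (i + n) = \<omega> (j + n)" for i j
    by blast
  \<comment> \<open>Pigeonhole: infinitely many positions, finitely many factors.\<close>
  have "\<not> inj (factor \<omega> n)"
    using fin finite_imageD infinite_UNIV_nat by blast
  then obtain i j where "i < j" and ij: "factor \<omega> n i = factor \<omega> n j"
    by (metis injI linorder_neqE_nat)
  have "factor \<omega> n (i + t) = factor \<omega> n (j + t)" for t
  proof (induction t)
    case (Suc t)
    have "\<omega> (i + Suc t + d) = \<omega> (j + Suc t + d)" if "d < n" for d
    proof (cases "Suc d < n")
      case True
      with Suc show ?thesis
        by (metis add.assoc add_Suc_right add_Suc factor_eq_iff)
    next
      case False
      with that have "n = Suc d" by simp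
      with det[OF Suc] show ?thesis by simp
    qed
    then show ?case by (simp add: factor_eq_iff)
  qed (use ij in simp)
  then have *: "\<omega> (i + t + n) = \<omega> (j + t + n)" for t
    using det by blast
  have "\<omega> (t + (j - i)) = \<omega> t" if "t \<ge> i + n" for t
    using *[of "t - i - n"] that \<open>i < j\<close> by (simp add: algebra_simps)
  then have "ultimately_periodic \<omega>"
    unfolding ultimately_periodic_def using \<open>i < j\<close> by (intro exI[of _ "j - i"]) auto
  with assms(1) show False by blast
qed

lemma Morse_Hedlund:
  assumes "\<not> ultimately_periodic \<omega>" and "finite (range (factor \<omega> n))"
  shows "n + 1 \<le> card (range (factor \<omega> n))"
  using assms(2)
proof (induction n)
  case 0
  have "card (range (factor \<omega> 0)) \<noteq> 0" using 0 by (simp only: card_eq_0_iff) blast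
  then show ?case by linarith
next
  case (Suc n)
  let ?F = "range (factor \<omega> (Suc n))"
  have im: "take n ` ?F = range (factor \<omega> n)"
    by (simp add: image_image take_factor)
  then have fin: "finite (range (factor \<omega> n))"
    using Suc.prems by (metis finite_imageI)
  obtain i j where ij: "factor \<omega> n i = factor \<omega> n j" "\<omega> (i + n) \<noteq> \<omega> (j + n)"
    using right_special_factor[OF assms(1) fin] .
  have ne: "factor \<omega> (Suc n) j \<noteq> factor \<omega> (Suc n) i"
    using ij(2) by (auto simp: factor_eq_iff)
  have "take n (factor \<omega> (Suc n) j) = take n (factor \<omega> (Suc n) i)"
    using ij(1) by (simp add: take_factor)
  with ne have "take n ` ?F \<subseteq> take n ` (?F - {factor \<omega> (Suc n) i})"
    by (smt (verit) Diff_iff image_iff image_subsetI rangeI singletonD)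
  from card_image_add_card_le[OF Suc.prems _ this] Suc.IH[OF fin] im show ?case
    by simp
qed

section \<open>States and their continuations\<close>

text \<open>Counting only the first \<open>b\<close> letters loses nothing, as the other
  \<open>m\<close> letters form the suffix window. It keeps the multiset independent of
  \<open>m\<close>, so raising \<open>m\<close> refines a state by two letters only.\<close>

definition state :: "(nat \<Rightarrow> 'a) \<Rightarrow> nat \<Rightarrow> nat \<Rightarrow> nat \<Rightarrow> 'a list \<times> 'a list \<times> 'a multiset" where
  "state \<omega> b m i = (factor \<omega> m i, factor \<omega> m (i + b), mset (factor \<omega> b i))"

definition continuation :: "(nat \<Rightarrow> 'a) \<Rightarrow> nat \<Rightarrow> nat \<Rightarrow> nat \<Rightarrow> 'a \<times> 'a" where
  "continuation \<omega> b m i = (\<omega> (i + m), \<omega> (i + b + m))"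

lemma state_eq_iff:
  "state \<omega> b m i = state \<omega> b m j \<longleftrightarrow>
     (\<forall>d<m. \<omega> (i + d) = \<omega> (j + d) \<and> \<omega> (i + b + d) = \<omega> (j + b + d))
     \<and> mset (factor \<omega> b i) = mset (factor \<omega> b j)"
  by (auto simp: state_def factor_eq_iff)

lemma state_Suc_eq_iff:
  "state \<omega> b (Suc m) i = state \<omega> b (Suc m) j \<longleftrightarrow>
     state \<omega> b m i = state \<omega> b m j \<and> continuation \<omega> b m i = continuation \<omega> b m j"
  by (auto simp: state_eq_iff continuation_def less_Suc_eq)

lemma state_step:
  assumes "state \<omega> b m i = state \<omega> b m j" "continuation \<omega> b m i = continuation \<omega> b m j"
  shows "state \<omega> b m (Suc i) = state \<omega> b m (Suc j)"
proof -
  have *: "\<omega> (i + d) = \<omega> (j + d) \<and> \<omega> (i + b + d) = \<omega> (j + b + d)" if "d \<le> m" for d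
    using that assms by (cases "d = m") (auto simp: state_eq_iff continuation_def)
  have "mset (factor \<omega> b i) = mset (factor \<omega> b j)"
    using assms by (simp add: state_eq_iff)
  \<comment> \<open>The letter leaving the multiset and the one entering it are known from
    \<open>*\<close> at 0; for \<open>m = 0\<close> they come from the continuation.\<close>
  then have "mset (factor \<omega> b (Suc i)) = mset (factor \<omega> b (Suc j))"
    using mset_factor_Suc[of \<omega> b i] mset_factor_Suc[of \<omega> b j] *[of 0]
    by (metis add_right_cancel add_0_right le0)
  moreover have "\<omega> (Suc i + d) = \<omega> (Suc j + d) \<and> \<omega> (Suc i + b + d) = \<omega> (Suc j + b + d)"
    if "d < m" for d
    using *[of "Suc d"] that by simp
  ultimately show ?thesis by (simp add: state_eq_iff)
qed

lemma factor_determines_state: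
  assumes "factor \<omega> (b + m) i = factor \<omega> (b + m) j"
  shows "state \<omega> b m i = state \<omega> b m j"
proof -
  have "factor \<omega> n i = factor \<omega> n j" if "n \<le> b + m" for n
    using assms that by (auto simp: factor_eq_iff)
  moreover have "factor \<omega> m (i + b) = factor \<omega> m (j + b)"
    using assms drop_factor by metis
  ultimately show ?thesis by (simp add: state_def)
qed

text \<open>As \<open>b\<close> is positive, each letter \<open>\<omega> i\<close> occurs in the
  multiset of the state at \<open>i\<close>; finitely many states thus allow finitely many letters,
  even over an infinite alphabet.\<close>

lemma finite_range_factor:
  assumes "finite (range (state \<omega> b m))" "b \<ge> 1"
  shows "finite (range (factor \<omega> n))"
proof -
  have "\<omega> i \<in> (\<Union>s\<in>range (state \<omega> b m). set_mset (snd (snd s)))" for i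
    using assms(2) by (auto simp: state_def factor_def intro!: exI[of _ i])
  then have "finite (range \<omega>)"
    using assms(1)
    by (intro finite_subset[of "range \<omega>" "\<Union>s\<in>range (state \<omega> b m). set_mset (snd (snd s))"]) blast+
  then have "finite {xs. set xs \<subseteq> range \<omega> \<and> length xs = n}"
    by (rule finite_lists_length_eq)
  then show ?thesis
    by (rule rev_finite_subset) (auto simp: factor_def)
qed

text \<open>Take two positions with the same state and different factors whose first difference \<open>d\<close> is least
  possible. Their continuations differ, since otherwise both positions could be advanced by one;
  so the state is the special one. At \<open>p\<close> and \<open>q\<close> the same factor occurs with both continuations,
  and it must differ from one of the two given factors within its first \<open>d + 1\<close> letters, while one
  of its occurrences has the same continuation as that factor: again both can be advanced.\<close>

lemma state_determines_factor:
  assumes sp: "factor \<omega> (b + m) p = factor \<omega> (b + m) q"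
    and nonspecial: "\<And>i j. state \<omega> b m i = state \<omega> b m j \<Longrightarrow> state \<omega> b m i \<noteq> state \<omega> b m p \<Longrightarrow>
        continuation \<omega> b m i = continuation \<omega> b m j"
    and special: "\<And>i. state \<omega> b m i = state \<omega> b m p \<Longrightarrow>
        continuation \<omega> b m i \<in> {continuation \<omega> b m p, continuation \<omega> b m q}"
    and "state \<omega> b m i = state \<omega> b m j"
  shows "factor \<omega> (b + m) i = factor \<omega> (b + m) j"
proof -
  let ?s = "state \<omega> b m" and ?z = "continuation \<omega> b m"
  have sq: "?s q = ?s p" using factor_determines_state[OF sp] by simp
  have "?s i = ?s j \<Longrightarrow> \<omega> (i + d) = \<omega> (j + d)" if "d < b + m" for d i j
    using that
  proof (induction d arbitrary: i j rule: less_induct)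
    case (less d)
    have agree: "\<omega> (i' + e) = \<omega> (j' + e)"
      if "?s i' = ?s j'" "?z i' = ?z j'" "e \<le> d" for i' j' e
    proof (cases "e < d")
      case True
      with less.IH[OF True that(1)] less.prems(2) show ?thesis by simp
    next
      case False
      \<comment> \<open>Here \<open>e = d\<close>. A positive offset is reduced by sliding both
        positions by one; at offset 0 the letter is in the prefix window, or in the continuation if
        that window is empty.\<close>
      show ?thesis
      proof (cases e)
        case 0
        have "\<omega> i' = \<omega> j'"
        proof (cases "m = 0")
          case True
          with that(2) show ?thesis by (simp add: continuation_def)
        next
          case False
          with that(1) show ?thesis by (auto simp: state_eq_iff dest: spec[of _ 0])
        qed
        with 0 show ?thesis by simp
      next
        case (Suc e')
        then show ?thesis
          using less.IH[of e' "Suc i'" "Suc j'"] state_step[OF that(1,2)] that(3) less.prems(2)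
          by simp
      qed
    qed
    show ?case
    proof (cases "?z i = ?z j")
      case True
      then show ?thesis using agree[OF less.prems(1)] by blast
    next
      case False
      then have si: "?s i = ?s p" "?s j = ?s p"
        using nonspecial[OF less.prems(1)] less.prems(1) by auto
      have pqd: "\<omega> (p + d) = \<omega> (q + d)"
        using sp less.prems(2) by (auto simp: factor_eq_iff)
      have "\<omega> (k + d) = \<omega> (p + d) \<or> \<omega> (k + d) = \<omega> (q + d)" if "?s k = ?s p" for k
      proof (cases "?z k = ?z p")
        case True
        then show ?thesis using agree[of k p d] that by blast
      next
        case False
        then have "?z k = ?z q" using special[OF that] by blast
        then show ?thesis using agree[of k q d] that sq by simp
      qed
      from this[OF si(1)] this[OF si(2)] pqd show ?thesis by auto
    qed
  qed
  with assms(4) show ?thesis unfolding factor_eq_iff by blast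
qed

section \<open>Growth of the number of states with \<open>m\<close>\<close>

lemma card_state_Suc:
  assumes aper: "\<not> ultimately_periodic \<omega>"
    and fin: "finite (range (state \<omega> b (Suc m)))" and "b \<ge> 1"
  shows "finite (range (state \<omega> b m))"
    and "card (range (state \<omega> b m)) + 1 \<le> card (range (state \<omega> b (Suc m)))"
    and "card (range (state \<omega> b m)) + 2 \<le> card (range (state \<omega> b (Suc m)))
      \<or> b + m + 1 \<le> card (range (state \<omega> b m))"
proof -
  let ?s = "state \<omega> b m" and ?z = "continuation \<omega> b m"
  let ?e = "\<lambda>i. (?s i, ?z i)"
  let ?E = "range ?e"
  have E: "finite ?E" "card ?E \<le> card (range (state \<omega> b (Suc m)))"
    using card_image_le_if_determined[OF fin, of ?e] by (auto simp: state_Suc_eq_iff)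
  have V: "fst ` ?E = range ?s" by (auto simp: image_image)
  then show finV: "finite (range ?s)" using finite_imageI[OF E(1), of fst] by simp
  note finF = finite_range_factor[OF finV \<open>b \<ge> 1\<close>]
  obtain p q where pq: "factor \<omega> (b + m) p = factor \<omega> (b + m) q"
      "\<omega> (p + (b + m)) \<noteq> \<omega> (q + (b + m))"
    using right_special_factor[OF aper finF] .
  have sq: "?s q = ?s p" using factor_determines_state[OF pq(1)] by simp
  have zq: "?z p \<noteq> ?z q" using pq(2) by (simp add: continuation_def add.assoc)
  \<comment> \<open>The pairs in \<open>?E\<close> stand for the states of order
    \<open>Suc m\<close>. A set \<open>D\<close> of pairs whose states all survive outside
    \<open>D\<close> measures the growth.\<close>
  have excess: "card (range ?s) + card D \<le> card (range (state \<omega> b (Suc m)))"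
    if D: "D \<subseteq> ?E" and keep: "\<And>i. ?e i \<in> D \<Longrightarrow> \<exists>j. ?e j \<notin> D \<and> ?s j = ?s i" for D
  proof -
    have "fst ` ?E \<subseteq> fst ` (?E - D)"
    proof
      fix x assume "x \<in> fst ` ?E"
      then obtain i where "x = ?s i" by auto
      with keep[of i] obtain j where "?e j \<notin> D" "?s j = x" by blast
      then show "x \<in> fst ` (?E - D)"
        by (intro image_eqI[of _ _ "?e j"]) (simp, blast)
    qed
    from card_image_add_card_le[OF E(1) D this] E(2) V show ?thesis by simp
  qed
  have "card (range ?s) + card {?e p} \<le> card (range (state \<omega> b (Suc m)))"
  proof (rule excess)
    fix l assume "?e l \<in> {?e p}"
    with sq zq show "\<exists>l'. ?e l' \<notin> {?e p} \<and> ?s l' = ?s l" by (intro exI[of _ q]) simp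
  qed blast
  then show "card (range ?s) + 1 \<le> card (range (state \<omega> b (Suc m)))" by simp
  show "card (range ?s) + 2 \<le> card (range (state \<omega> b (Suc m))) \<or> b + m + 1 \<le> card (range ?s)"
  proof (rule disjCI)
    assume small: "\<not> b + m + 1 \<le> card (range ?s)"
    show "card (range ?s) + 2 \<le> card (range (state \<omega> b (Suc m)))"
    proof (rule ccontr)
      assume few: "\<not> ?thesis"
      \<comment> \<open>A second branching state would make both \<open>?e i\<close> and
        \<open>?e p\<close> removable, with \<open>?e j\<close> and \<open>?e q\<close> keeping
        their states.\<close>
      have nonspecial: "?z i = ?z j" if "?s i = ?s j" "?s i \<noteq> ?s p" for i j
      proof (rule ccontr)
        assume ne: "?z i \<noteq> ?z j"
        have "card (range ?s) + card {?e i, ?e p} \<le> card (range (state \<omega> b (Suc m)))"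
        proof (rule excess)
          fix l assume "?e l \<in> {?e i, ?e p}"
          then consider "?s l = ?s i" | "?s l = ?s p" by blast
          then show "\<exists>l'. ?e l' \<notin> {?e i, ?e p} \<and> ?s l' = ?s l"
          proof cases
            case 1
            with that ne show ?thesis by (intro exI[of _ j]) simp
          next
            case 2
            with that sq zq show ?thesis by (intro exI[of _ q]) simp
          qed
        qed blast
        with few that show False by auto
      qed
      \<comment> \<open>A third continuation would make \<open>?e i\<close> and \<open>?e p\<close>
        removable, with \<open>?e q\<close> keeping their common state.\<close>
      have special: "?z i \<in> {?z p, ?z q}" if "?s i = ?s p" for i
      proof (rule ccontr)
        assume ne: "?z i \<notin> {?z p, ?z q}"
        have "card (range ?s) + card {?e i, ?e p} \<le> card (range (state \<omega> b (Suc m)))"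
        proof (rule excess)
          fix l assume "?e l \<in> {?e i, ?e p}"
          then have "?s l = ?s p" using that by auto
          moreover have "?z q \<noteq> ?z i" using ne by auto
          ultimately show "\<exists>l'. ?e l' \<notin> {?e i, ?e p} \<and> ?s l' = ?s l"
            using sq zq by (intro exI[of _ q]) simp
        qed blast
        with few ne show False by auto
      qed
      have "factor \<omega> (b + m) i = factor \<omega> (b + m) j" if "?s i = ?s j" for i j
        using state_determines_factor[OF pq(1) nonspecial special that] .
      then have "card (range (factor \<omega> (b + m))) \<le> card (range ?s)"
        using card_image_le_if_determined(2)[OF finV, of "factor \<omega> (b + m)"] by blast
      with Morse_Hedlund[OF aper finF, of "b + m"] small show False by simp
    qed
  qed
qed

lemma card_state_ge:
  assumes aper: "\<not> ultimately_periodic \<omega>"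
    and "finite (range (state \<omega> b m))" and "m < b"
  shows "2 * m + 2 \<le> card (range (state \<omega> b m))"
  using assms(2,3)
proof (induction m)
  case 0
  show ?case
  proof (rule ccontr)
    assume "\<not> ?case"
    then have "card (range (state \<omega> b 0)) \<le> Suc 0" by simp
    then have const: "state \<omega> b 0 i = state \<omega> b 0 j" for i j
      using card_le_Suc0_iff_eq[OF 0(1)] by blast
    \<comment> \<open>With a constant multiset, the letter entering the window equals the one
      leaving it.\<close>
    have "\<omega> (i + b) = \<omega> i" for i
      using mset_factor_Suc[of \<omega> b i] const[of "Suc i" i] by (simp add: state_eq_iff)
    then have "ultimately_periodic \<omega>"
      unfolding ultimately_periodic_def using 0 by (intro exI[of _ b]) auto
    with aper show False by blast
  qed
next
  case (Suc m)
  then have "b \<ge> 1" by simp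
  note step = card_state_Suc[OF aper Suc.prems(1) this]
  have "2 * m + 2 \<le> card (range (state \<omega> b m))"
    using Suc.IH[OF step(1)] Suc.prems(2) by simp
  \<comment> \<open>In the second alternative there are at least \<open>b + m + 2\<close> states of
    order \<open>Suc m\<close>, and \<open>b \<ge> m + 2\<close> makes this at least
    \<open>2 * m + 4\<close>.\<close>
  with step(2,3) Suc.prems(2) show ?case by auto
qed

section \<open>From equivalence classes to states and factors\<close>

lemma k_rel_imp_window_eq:
  assumes "(u, v) \<in> k_rel (enat (Suc m))" and "length u = length v" and "length u = b + m"
  shows "take m u = take m v \<and> drop b u = drop b v \<and> mset (take b u) = mset (take b v)"
proof -
  have "enat (Suc m) - 1 = enat m" by (simp add: one_enat_def)
  with assms obtain p s where ps: "length p = m" "prefix p u" "prefix p v"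
      "length s = m" "suffix s u" "suffix s v" and ab: "abelian_equivalent u v"
    unfolding k_rel_def by auto
  have "take m u = p" "take m v = p"
    using ps(1-3) by (auto simp: prefix_def)
  moreover have "drop b u = s" "drop b v = s"
    using ps(4-6) assms(2,3) by (auto simp: suffix_def)
  moreover have "mset u = mset v"
    using ab by (simp add: abelian_equivalent_def multiset_eq_iff count_mset)
  \<comment> \<open>The common suffix cancels from the two equal multisets.\<close>
  then have "mset (take b u) + mset (drop b u) = mset (take b v) + mset (drop b v)"
    by (simp flip: mset_append)
  ultimately show ?thesis by simp
qed

text \<open>Prefix and suffix of length \<open>m\<close> leave at most one middle letter uncovered,
  and the multiset supplies it.\<close>

lemma k_rel_short_imp_eq:
  assumes "(u, v) \<in> k_rel (enat (Suc m))" and len: "length u = length v"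
    and "length u \<le> 2 * m + 1"
  shows "u = v"
proof (cases "length u < m")
  case True
  with assms(1) show ?thesis by (auto simp: k_rel_def one_enat_def)
next
  case False
  define b where "b = length u - m"
  have b: "length u = b + m" using False by (simp add: b_def)
  note w = k_rel_imp_window_eq[OF assms(1) len b]
  have "take b u = take b v"
  proof (cases "b \<le> m")
    case True
    then have "take b (take m u) = take b u" "take b (take m v) = take b v"
      by (simp_all add: min_absorb1)
    with w show ?thesis by metis
  next
    case False
    with assms(3) b have bm: "b = Suc m" by simp
    with len b have "take b u = take m u @ [u ! m]" "take b v = take m v @ [v ! m]"
      by (simp_all add: take_Suc_conv_app_nth)
    moreover from this w have "u ! m = v ! m" by simp
    ultimately show ?thesis using w by simp
  qed
  with w have "take b u @ drop b u = take b v @ drop b v" by metis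
  then show ?thesis by (simp only: append_take_drop_id)
qed

text \<open>Anything constant on classes takes at most as many values as there are classes; a finite
  bound in \<open>enat\<close> also makes the quotient finite.\<close>

lemma complexity_ge_card_image:
  assumes "complexity k \<omega> n < enat N"
    and "\<And>i j. (factor \<omega> n i, factor \<omega> n j) \<in> k_rel k \<Longrightarrow> g i = g j"
  shows "finite (range g)" and "card (range g) < N"
proof -
  let ?c = "\<lambda>i. k_rel k `` {factor \<omega> n i}"
  have "factors_of_length \<omega> n // k_rel k = range ?c"
    by (auto simp: quotient_def factors_of_length_eq)
  with assms(1) have fin: "finite (range ?c)" and lt: "card (range ?c) < N"
    by (auto simp: complexity_def ecard_def split: if_splits)
  have det: "g i = g j" if "?c i = ?c j" for i j
    using eq_equiv_class[OF that equiv_k_rel UNIV_I] by (rule assms(2))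
  show "finite (range g)"
    by (rule card_image_le_if_determined(1)[OF fin]) (rule det)
  have "card (range g) \<le> card (range ?c)"
    by (rule card_image_le_if_determined(2)[OF fin]) (rule det)
  with lt show "card (range g) < N" by simp
qed

theorem theorem16:
  fixes \<omega> :: "nat \<Rightarrow> 'a" and k :: enat
  assumes "k \<ge> 1"
    and "\<exists>n\<^sub>0\<ge>1. complexity k \<omega> n\<^sub>0 < q_bound k n\<^sub>0"
  shows "ultimately_periodic \<omega>"
proof (rule ccontr)
  assume aper: "\<not> ultimately_periodic \<omega>"
  from assms(2) obtain n where n: "complexity k \<omega> n < q_bound k n" by blast
  \<comment> \<open>Covers every case in which the relation separates distinct factors of length
    \<open>n\<close>: infinite \<open>k\<close>, or \<open>n \<le> 2 * m + 1\<close>.\<close>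
  have short: False
    if "complexity k \<omega> n < enat (n + 1)"
      "\<And>i j. (factor \<omega> n i, factor \<omega> n j) \<in> k_rel k \<Longrightarrow> factor \<omega> n i = factor \<omega> n j"
  proof -
    from complexity_ge_card_image[OF that] have "finite (range (factor \<omega> n))"
      and "card (range (factor \<omega> n)) < n + 1" by auto
    with Morse_Hedlund[OF aper, of n] show False by simp
  qed
  show False
  proof (cases k)
    case infinity
    with n short show False by (simp add: q_bound_infinity)
  next
    case (enat k')
    with assms(1) obtain m where k: "k = enat (Suc m)"
      by (cases k') (auto simp: one_enat_def)
    show False
    proof (cases "n \<le> 2 * m + 1")
      case True
      with n k have "complexity k \<omega> n < enat (n + 1)" by (simp add: q_bound_enat)
      with True k show False by (auto intro!: short k_rel_short_imp_eq)
    next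
      case False
      \<comment> \<open>Now \<open>n \<ge> 2 * m + 2\<close>, which is exactly what gives
        \<open>m < b\<close>; the bound \<open>2 * k\<close> reads \<open>2 * m + 2\<close>.\<close>
      define b where "b = n - m"
      have b: "n = b + m" "m < b" using False by (auto simp: b_def)
      have lt: "complexity k \<omega> n < enat (2 * m + 2)"
        using n k False by (simp add: q_bound_enat)
      have "state \<omega> b m i = state \<omega> b m j"
        if "(factor \<omega> n i, factor \<omega> n j) \<in> k_rel k" for i j
        using k_rel_imp_window_eq[of "factor \<omega> n i" "factor \<omega> n j" m b] that k b
        by (simp add: state_def take_factor drop_factor)
      from complexity_ge_card_image[OF lt this]
      have "finite (range (state \<omega> b m))" "card (range (state \<omega> b m)) < 2 * m + 2"
        by auto
      with card_state_ge[OF aper _ b(2)] show False by (simp add: leD)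
    qed
  qed
qed

end
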